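(* Let $X$ be a topological space and let $\mathcal{P}(X)$ be its power set ring. Then $X$ is quasi-compact if and only if every maximal ideal of $\mathcal{P}(X)$ converges to a point of $X$ (i.e. to at least one point of $X$).
   Context: For a set $X$, the power set ring $\mathcal{P}(X)$ is the commutative ring whose elements are the subsets of $X$, with addition the symmetric difference $A+B=(A\cup B)\setminus(A\cap B)$ and multiplication $A\cdot B=A\cap B$; its zero is $\emptyset$ and its unit is $X$. If $X$ is a topological space, $x\in X$ and $M$ is a maximal ideal of $\mathcal{P}(X)$, then $M$ is said to be convergent to (or to converge to) $x$ if for every open subset $U$ of $X$ containing $x$ one has $U\notin M$. Quasi-compact means that every open covering has a finite subcovering (no separation axiom is assumed). *)

theory Defs
  imports "HOL-Algebra.Ideal" "HOL-Analysis.Abstract_Topology"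
begin

definition powerset_ring :: "'a set \<Rightarrow> 'a set ring" where
  "powerset_ring S =
    \<lparr>carrier = Pow S, mult = (\<lambda>A B. A \<inter> B), one = S,
     zero = {}, add = (\<lambda>A B. (A \<union> B) - (A \<inter> B))\<rparr>"

lemma cring_powerset_ring: "cring (powerset_ring S)"
proof (rule cringI)
  show "abelian_group (powerset_ring S)"
  proof (rule abelian_groupI)
    fix x assume "x \<in> carrier (powerset_ring S)"
    then show "\<exists>y\<in>carrier (powerset_ring S).
        y \<oplus>\<^bsub>powerset_ring S\<^esub> x = \<zero>\<^bsub>powerset_ring S\<^esub>"
      by (intro bexI[of _ x]) (auto simp: powerset_ring_def)
  qed (auto simp: powerset_ring_def)
  show "comm_monoid (powerset_ring S)"
    by (rule comm_monoidI) (auto simp: powerset_ring_def)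
qed (auto simp: powerset_ring_def)

definition ideal_converges_to :: "'a topology \<Rightarrow> 'a set set \<Rightarrow> 'a \<Rightarrow> bool" where
  "ideal_converges_to X M x \<longleftrightarrow> (\<forall>U. openin X U \<and> x \<in> U \<longrightarrow> U \<notin> M)"

end

theory Submission
  imports Defs "HOL-Algebra.Ring_Divisibility"
begin

text \<open>
  Ideals of the power set ring are the set-theoretic ideals: families of subsets closed under
  passing to smaller sets and under binary, hence finite, unions. Such an ideal is proper exactly
  when it omits the whole space. Compactness speaks of families of open sets no finite union of
  which is the whole space, so proper ideals and families without finite subcovers match.

  If a maximal ideal converges to no point, then each point has an open neighbourhood belonging
  to the ideal, and a finite subcover puts the whole space into the ideal, contradicting
  properness. Conversely, for an open cover without finite subcover, the subsets covered by
  finitely many of its members form a proper ideal. A maximal ideal above it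
  (\<open>proper_ideal_le_maximal\<close>, an application of Zorn's lemma) contains every member of the cover,
  and each point lies in one of them, so that ideal has no limit.
\<close>

text \<open>
  The only obstruction to applying Zorn's lemma is properness of the union of a chain, and
  properness is the condition \<open>\<one> \<notin> J\<close>, which does survive unions.
\<close>

lemma (in ring) proper_ideal_le_maximal:
  assumes "ideal I R" and "\<one> \<notin> I"
  obtains M where "maximalideal M R" and "I \<subseteq> M"
proof -
  define \<A> where "\<A> = {J. ideal J R \<and> I \<subseteq> J \<and> \<one> \<notin> J}"
  have "\<exists>M\<in>\<A>. \<forall>J\<in>\<A>. M \<subseteq> J \<longrightarrow> J = M"
  proof (rule subset_Zorn_nonempty)
    show "\<A> \<noteq> {}"
      using assms by (auto simp: \<A>_def)
    fix C assume "C \<noteq> {}" and "subset.chain \<A> C"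
    then have "C \<subseteq> \<A>" and "subset.chain {J. ideal J R} C"
      by (auto simp: \<A>_def subset.chain_def)
    then have "ideal (\<Union>C) R"
      using chain_Union_is_ideal[of C] \<open>C \<noteq> {}\<close> by simp
    then show "\<Union>C \<in> \<A>"
      using \<open>C \<noteq> {}\<close> \<open>C \<subseteq> \<A>\<close> by (auto simp: \<A>_def)
  qed
  then obtain M where M: "ideal M R" "I \<subseteq> M" "\<one> \<notin> M"
    and max: "\<And>J. ideal J R \<Longrightarrow> \<one> \<notin> J \<Longrightarrow> M \<subseteq> J \<Longrightarrow> J = M"
    by (auto simp: \<A>_def)
  have "maximalideal M R"
  proof (rule maximalidealI[OF M(1)])
    show "carrier R \<noteq> M"
      using M(3) by auto
    show "J = M \<or> J = carrier R" if "ideal J R" "M \<subseteq> J" for J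
      using max[OF that(1) _ that(2)] ideal.one_imp_carrier[OF that(1)] by blast
  qed
  with M(2) show thesis
    using that by blast
qed

text \<open>
  Addition is symmetric difference and multiplication is intersection, so
  \<open>A \<union> B = A + (B \<inter> (S - A))\<close> trades sums for unions, while absorption says precisely that
  subsets of members are members.
\<close>

lemma ideal_powerset_ring_iff:
  "ideal I (powerset_ring S) \<longleftrightarrow>
    I \<subseteq> Pow S \<and> {} \<in> I \<and> (\<forall>A\<in>I. \<forall>B\<subseteq>A. B \<in> I) \<and> (\<forall>A\<in>I. \<forall>B\<in>I. A \<union> B \<in> I)"
  (is "?L \<longleftrightarrow> ?R")
proof
  assume ?L
  then interpret ideal I "powerset_ring S" .
  have sub: "I \<subseteq> Pow S" and zero: "{} \<in> I"
    using a_subset additive_subgroup.zero_closed[OF is_additive_subgroup]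
    by (simp_all add: powerset_ring_def)
  have down: "B \<in> I" if "A \<in> I" "B \<subseteq> A" for A B
    using I_l_closed[OF that(1), of B] that sub
    by (auto simp: powerset_ring_def Int_absorb2)
  have "A \<union> B \<in> I" if "A \<in> I" "B \<in> I" for A B
  proof -
    have "B - A \<in> I"
      using down[OF that(2)] by blast
    from additive_subgroup.a_closed[OF is_additive_subgroup that(1) this]
    have "A \<union> (B - A) - A \<inter> (B - A) \<in> I"
      by (simp add: powerset_ring_def)
    moreover have "A \<union> (B - A) - A \<inter> (B - A) = A \<union> B"
      by blast
    ultimately show ?thesis
      by simp
  qed
  with sub zero down show ?R
    by (intro conjI ballI allI impI)
next
  assume R: ?R
  then have sub: "I \<subseteq> Pow S" and zero: "{} \<in> I"
    by simp_all
  from R have down: "B \<in> I" if "A \<in> I" "B \<subseteq> A" for A B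
    using that by meson
  from R have Un: "A \<union> B \<in> I" if "A \<in> I" "B \<in> I" for A B
    using that by meson
  interpret cring "powerset_ring S"
    by (rule cring_powerset_ring)
  show ?L
  proof (rule idealI[OF ring_axioms])
    show "subgroup I (add_monoid (powerset_ring S))"
    proof (rule add.subgroupI)
      show "I \<subseteq> carrier (powerset_ring S)" "I \<noteq> {}"
        using sub zero by (auto simp: powerset_ring_def)
      fix A B assume "A \<in> I"
      have "\<ominus>\<^bsub>powerset_ring S\<^esub> A = A"
        by (rule minus_equality) (use sub \<open>A \<in> I\<close> in \<open>auto simp: powerset_ring_def\<close>)
      with \<open>A \<in> I\<close> show "\<ominus>\<^bsub>powerset_ring S\<^esub> A \<in> I"
        by simp
      assume "B \<in> I"
      with \<open>A \<in> I\<close> have "A \<union> B - A \<inter> B \<in> I"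
        by (intro down[OF Un Diff_subset])
      then show "A \<oplus>\<^bsub>powerset_ring S\<^esub> B \<in> I"
        by (simp add: powerset_ring_def)
    qed
  next
    fix A B assume "A \<in> I"
    then show "B \<otimes>\<^bsub>powerset_ring S\<^esub> A \<in> I" "A \<otimes>\<^bsub>powerset_ring S\<^esub> B \<in> I"
      by (simp_all add: powerset_ring_def down)
  qed
qed

lemma ideal_powerset_ring_Union:
  assumes "ideal I (powerset_ring S)" and "finite F" and "F \<subseteq> I"
  shows "\<Union>F \<in> I"
proof -
  have empty: "{} \<in> I" and Un: "\<And>A B. A \<in> I \<Longrightarrow> B \<in> I \<Longrightarrow> A \<union> B \<in> I"
    using assms(1) unfolding ideal_powerset_ring_iff by simp_all
  from assms(2,3) show ?thesis
    by (induction F rule: finite_induct) (simp_all add: empty Un)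
qed

lemma maximalideal_powerset_ring_whole_notin:
  assumes "maximalideal M (powerset_ring S)"
  shows "S \<notin> M"
proof -
  interpret maximalideal M "powerset_ring S"
    by fact
  show ?thesis
    using one_imp_carrier I_notcarr by (auto simp: powerset_ring_def)
qed

theorem theorem3p1:
  fixes X :: "'a topology"
  shows "compact_space X \<longleftrightarrow>
    (\<forall>M. maximalideal M (powerset_ring (topspace X)) \<longrightarrow>
      (\<exists>x\<in>topspace X. ideal_converges_to X M x))"
proof (intro iffI allI impI)
  fix M
  assume cpt: "compact_space X" and M: "maximalideal M (powerset_ring (topspace X))"
  show "\<exists>x\<in>topspace X. ideal_converges_to X M x"
  proof (rule ccontr)
    assume "\<not> ?thesis"
    then have "topspace X \<subseteq> \<Union>{U \<in> M. openin X U}"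
      by (auto simp: ideal_converges_to_def)
    with cpt obtain F where F: "finite F" "F \<subseteq> {U \<in> M. openin X U}" "topspace X \<subseteq> \<Union>F"
      unfolding compact_space_alt by (metis (no_types, lifting) mem_Collect_eq)
    then have "\<Union>F = topspace X"
      by (intro subset_antisym Union_least) (auto dest: openin_subset)
    moreover have "\<Union>F \<in> M"
      using F by (intro ideal_powerset_ring_Union[OF maximalideal.axioms(1)[OF M]]) auto
    ultimately show False
      using maximalideal_powerset_ring_whole_notin[OF M] by simp
  qed
next
  assume conv: "\<forall>M. maximalideal M (powerset_ring (topspace X)) \<longrightarrow>
    (\<exists>x\<in>topspace X. ideal_converges_to X M x)"
  show "compact_space X"
    unfolding compact_space
  proof (intro allI impI, elim conjE, rule ccontr)
    fix \<U> assume op: "\<forall>U\<in>\<U>. openin X U" and cover: "\<Union>\<U> = topspace X"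
      and no_subcover: "\<nexists>F. finite F \<and> F \<subseteq> \<U> \<and> \<Union>F = topspace X"
    define I where "I = {A. \<exists>F. finite F \<and> F \<subseteq> \<U> \<and> A \<subseteq> \<Union>F}"
    have "ideal I (powerset_ring (topspace X))"
      unfolding ideal_powerset_ring_iff
    proof (intro conjI ballI allI impI)
      show "I \<subseteq> Pow (topspace X)"
        using Union_mono[of _ \<U>] unfolding cover[symmetric] I_def by blast
      show "{} \<in> I"
        by (auto simp: I_def)
      show "B \<in> I" if "A \<in> I" "B \<subseteq> A" for A B
        using that unfolding I_def by (simp, meson order_trans)
      fix A B assume "A \<in> I" "B \<in> I"
      then obtain F G where "finite F" "F \<subseteq> \<U>" "A \<subseteq> \<Union>F" "finite G" "G \<subseteq> \<U>" "B \<subseteq> \<Union>G"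
        by (auto simp: I_def)
      then show "A \<union> B \<in> I"
        unfolding I_def by (intro CollectI exI[of _ "F \<union> G"]) auto
    qed
    moreover have "\<one>\<^bsub>powerset_ring (topspace X)\<^esub> \<notin> I"
    proof
      assume "\<one>\<^bsub>powerset_ring (topspace X)\<^esub> \<in> I"
      then obtain F where F: "finite F" "F \<subseteq> \<U>" "topspace X \<subseteq> \<Union>F"
        unfolding I_def powerset_ring_def by auto
      with cover have "\<Union>F = topspace X"
        using Union_mono[of F \<U>] by simp
      with no_subcover F show False
        by simp
    qed
    ultimately obtain M where M: "maximalideal M (powerset_ring (topspace X))" and "I \<subseteq> M"
      using ring.proper_ideal_le_maximal[OF cring.axioms(1)[OF cring_powerset_ring]] by blast
    from conv M obtain x where x: "x \<in> topspace X" "ideal_converges_to X M x"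
      by blast
    with cover obtain U where U: "U \<in> \<U>" "x \<in> U"
      by blast
    then have "U \<in> I"
      unfolding I_def by (intro CollectI exI[of _ "{U}"]) auto
    with \<open>I \<subseteq> M\<close> x(2) U op show False
      by (auto simp: ideal_converges_to_def)
  qed
qed

end
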